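(* Consider $n$-chains for integers $n\geqslant 4$. Then the following hold, where $\|$ denotes a (possibly empty) list of zeroes whose length is such that the whole tuple has exactly $n$ components. The perfect chains are exactly: $$(1,2,1,0)\ (n=4),\qquad (2,0,2,0)\ (n=4),\qquad (2,1,2,0,0)\ (n=5),$$ $$(n-4,\,2,\,1\,\|\,1,0,0,0)\quad\text{for each } n\geqslant 7.$$ The (unordered) pairs of amicable chains are exactly: $$\{(2,3,0,1,0,0),\ (3,1,1,1,0,0)\}\ (n=6),$$ $$\{(n-4,\,3,\,0,\,0\,\|\,0,1,0,0),\ (n-3,\,1,\,0,\,1\,\|\,1,0,0,0)\}\quad\text{for each } n\geqslant 8.$$ The unique group of sociable chains (up to cyclic rotation of the listing) is, for $n=7$, $$(3,3,0,0,1,0,0),\quad (4,1,0,2,0,0,0),\quad (4,1,1,0,1,0,0).$$ There is no group of more than $3$ sociable chains.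
   Context: For an integer $n\geqslant 1$ let $N=\{0,1,\ldots,n-1\}$. An $n$-chain is an $n$-tuple $\mathbf{x}=(x_0,x_1,\ldots,x_{n-1})$ with $x_i\in N$ for all $i\in N$; the set of all $n$-chains is denoted $N^N$. The counting operator $s:N^N\to\{0,1,\ldots,n\}^N$ is defined by $s(\mathbf{x})=\mathbf{x}'$ with $x'_j=|\{i\in N : x_i=j\}|$ for $j\in N$. An $n$-chain $\mathbf{x}$ is perfect if $s(\mathbf{x})=\mathbf{x}$. Two $n$-chains $\mathbf{x}\neq\mathbf{x}'$ form a pair of amicable chains if $s(\mathbf{x})=\mathbf{x}'$ and $s(\mathbf{x}')=\mathbf{x}$. For an integer $l\geqslant 3$, $n$-chains $\mathbf{x}^{(0)},\ldots,\mathbf{x}^{(l-1)}\in N^N$ with $\mathbf{x}^{(k+1)}=s(\mathbf{x}^{(k)})$ for $k\in\{0,\ldots,l-2\}$ form a group of $l$ sociable chains if they are distinct and $s(\mathbf{x}^{(l-1)})=\mathbf{x}^{(0)}$. *)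

theory Defs
  imports Main
begin

definition n_chains :: "nat \<Rightarrow> nat list set" where
  "n_chains n = {x. length x = n \<and> (\<forall>i<n. x ! i < n)}"

(* The number n of components is recovered from the list as its length.  The result has
   entries in {0..n}, so it need not be an n-chain: for x = (0,...,0) the entry n occurs. *)
definition counting :: "nat list \<Rightarrow> nat list" where
  "counting x = map (\<lambda>j. card {i. i < length x \<and> x ! i = j}) [0..<length x]"

definition perfect_chain :: "nat \<Rightarrow> nat list \<Rightarrow> bool" where
  "perfect_chain n x \<longleftrightarrow> x \<in> n_chains n \<and> counting x = x"

definition amicable_chains :: "nat \<Rightarrow> nat list \<Rightarrow> nat list \<Rightarrow> bool" where
  "amicable_chains n x y \<longleftrightarrow>
     x \<in> n_chains n \<and> y \<in> n_chains n \<and> x \<noteq> y \<and> counting x = y \<and> counting y = x"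

(* xs is the listing x^(0), ..., x^(l-1) of the group. *)
definition sociable_chains :: "nat \<Rightarrow> nat \<Rightarrow> nat list list \<Rightarrow> bool" where
  "sociable_chains n l xs \<longleftrightarrow>
     l \<ge> 3 \<and> length xs = l \<and> (\<forall>k<l. xs ! k \<in> n_chains n) \<and>
     (\<forall>k. k + 1 < l \<longrightarrow> xs ! (k + 1) = counting (xs ! k)) \<and>
     distinct xs \<and> counting (xs ! (l - 1)) = xs ! 0"

end

theory Submission
  imports Defs "HOL-Library.Multiset"
begin

text \<open>
  A cycle of the counting operator is a finite set \<open>C\<close> of chains with \<open>counting ` C = C\<close>. The image
  of a chain depends only on the multiset \<open>M\<close> of its nonzero entries, and the nonzero entries of
  the image are \<open>n - size M\<close> together with the multiplicities in \<open>M\<close>, which sum to \<open>size M\<close>.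
  Distinct positive numbers with sum \<open>k\<close> are at most about \<open>sqrt (2 * k)\<close> many, so two applications of
  the operator bring the number of nonzero entries down until it is at most 4; on a cycle it is
  therefore always at most 4. Hence on a cycle \<open>M\<close> is one of ten multisets
  \<open>add_mset (n - sum_mset L) L\<close> with \<open>sum_mset L \<le> 4\<close>, and following the operator on these leaves
  only the listed chains.
\<close>

section \<open>The counting operator on multisets of nonzero entries\<close>

definition nonzeros :: "nat list \<Rightarrow> nat multiset" where
  "nonzeros x = filter_mset (\<lambda>v. v \<noteq> 0) (mset x)"

definition tally :: "nat \<Rightarrow> nat multiset \<Rightarrow> nat list" where
  "tally n M = map (\<lambda>j. if j = 0 then n - size M else count M j) [0..<n]"

definition step :: "nat \<Rightarrow> nat multiset \<Rightarrow> nat multiset" where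
  "step n M = add_mset (n - size M) (image_mset (count M) (mset_set (set_mset M)))"

lemma counting_eq_tally: "counting x = tally (length x) (nonzeros x)"
proof -
  have card_eq: "card {i. i < length x \<and> x ! i = j} = count (mset x) j" for j
    by (simp add: count_mset count_list_eq_length_filter length_filter_conv_card eq_commute)
  have "size (mset x) = size (nonzeros x) + size (filter_mset (\<lambda>v. \<not> v \<noteq> 0) (mset x))"
    using arg_cong[OF multiset_partition[of "mset x" "\<lambda>v. v \<noteq> 0"], of size]
    unfolding nonzeros_def size_union .
  also have "filter_mset (\<lambda>v. \<not> v \<noteq> 0) (mset x) = replicate_mset (count (mset x) 0) 0"
    by (simp add: filter_eq_replicate_mset)
  finally have "count (mset x) 0 = length x - size (nonzeros x)"
    by simp
  then show ?thesis
    by (auto simp: counting_def tally_def card_eq nonzeros_def)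
qed

text \<open>The hypotheses keep position 0 apart from the values in \<open>M\<close>, make its entry
  \<open>n - size M\<close> positive, and place every value of \<open>M\<close> among the positions
  below \<open>n\<close>. The nonzero positions are then 0 and the members of
  \<open>M\<close>.\<close>

lemma nonzeros_tally:
  assumes "size M < n" and "0 \<notin># M" and "\<And>v. v \<in># M \<Longrightarrow> v < n"
  shows "nonzeros (tally n M) = step n M"
proof -
  define h where "h = (\<lambda>j. if j = 0 then n - size M else count M j)"
  have "nonzeros (tally n M) = image_mset h (filter_mset (\<lambda>j. h j \<noteq> 0) (mset_set {0..<n}))"
    unfolding nonzeros_def tally_def h_def[symmetric]
    by (simp add: filter_mset_image_mset comp_def)
  also have "filter_mset (\<lambda>j. h j \<noteq> 0) (mset_set {0..<n}) = mset_set {j \<in> {0..<n}. h j \<noteq> 0}"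
    by simp
  also have "{j \<in> {0..<n}. h j \<noteq> 0} = insert 0 (set_mset M)"
    using assms by (auto simp: h_def split: if_splits)
  also have "image_mset h (mset_set (insert 0 (set_mset M))) = step n M"
    using assms by (auto simp: step_def h_def intro!: image_mset_cong)
  finally show ?thesis .
qed

section \<open>Estimates for sums and sizes, and the small multisets\<close>

lemma sum_image_count: "sum_mset (image_mset (count M) (mset_set (set_mset M))) = size M"
  by (simp add: size_multiset_overloaded_eq sum_unfold_sum_mset)

lemma sum_set_mset_le: "\<Sum>(set_mset M) \<le> sum_mset (M :: nat multiset)"
proof (induction M)
  case (add v M)
  then show ?case by (cases "v \<in># M") (auto simp: insert_absorb)
qed simp

text \<open>The sum is least for {1,...,k}. In the induction the new maximum \<open>m\<close>
  exceeds \<open>card A\<close> because \<open>A\<close> lies in {1,...,m-1}.\<close>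

lemma card_mult_Suc_card_le_sum:
  fixes A :: "nat set"
  assumes "finite A" and "0 \<notin> A"
  shows "card A * (card A + 1) \<le> 2 * \<Sum>A"
  using assms
proof (induction A rule: finite_linorder_max_induct)
  case (insert m A)
  have "A \<subseteq> {1..<m}"
    using insert.hyps(2) insert.prems by (metis atLeastLessThan_iff less_one not_le subsetI insertCI)
  then have "card A \<le> m - 1"
    using card_mono[of "{1..<m}" A] by simp
  then have le: "card A + 1 \<le> m"
    using insert.prems by auto
  have "m \<notin> A" using insert.hyps(2) by blast
  then show ?case
    using insert le by (simp add: algebra_simps)
qed simp

text \<open>If no entry were zero, the sum \<open>n\<close> of \<open>n\<close> positive entries
  would force all of them to be 1. The image would then have the entry \<open>n\<close> at position
  1, which no chain allows; for \<open>n = 1\<close> the entry 1 is itself too large.\<close>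

lemma size_nonzeros_lt:
  assumes "x \<in> n_chains n" and "counting x \<in> n_chains n" and "sum_list x = n" and "n > 0"
  shows "size (nonzeros x) < n"
proof (rule ccontr)
  assume "\<not> size (nonzeros x) < n"
  have len: "length x = n" using assms(1) by (simp add: n_chains_def)
  have "length (filter (\<lambda>v. v \<noteq> 0) x) = length x"
    using \<open>\<not> _\<close> len length_filter_le[of "\<lambda>v. v \<noteq> 0" x]
    by (simp add: nonzeros_def flip: mset_filter)
  then have "\<forall>v\<in>set x. v \<noteq> 0"
    using length_filter_less[of _ x "\<lambda>v. v \<noteq> 0"] by fastforce
  then have pos: "\<forall>i<n. x ! i \<ge> 1"
    using len by (simp add: all_set_conv_all_nth Suc_le_eq)
  have "(\<Sum>i<n. x ! i - 1) + (\<Sum>i<n. 1) = (\<Sum>i<n. x ! i)"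
    using pos by (subst sum.distrib[symmetric]) (auto intro!: sum.cong)
  also have "\<dots> = n"
    using assms(3) len by (simp add: sum_list_sum_nth atLeast0LessThan)
  finally have "(\<Sum>i<n. x ! i - 1) = 0" by simp
  then have "\<forall>i<n. x ! i = 1"
    using pos by (auto simp: le_antisym)
  then have ones: "{i. i < length x \<and> x ! i = 1} = {..<n}"
    using len by auto
  show False
  proof (cases "n = 1")
    case True
    then show False using assms(1) \<open>\<forall>i<n. x ! i = 1\<close> by (auto simp: n_chains_def)
  next
    case False
    then have "counting x ! 1 = n"
      using ones len assms(4) by (simp add: counting_def)
    moreover have "counting x ! 1 < n"
      using assms(2,4) False by (simp add: n_chains_def)
    ultimately show False by simp
  qed
qed

text \<open>The fibres of \<open>x\<close> partition the positions. As every chain on a cycle is an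
  image, this supplies the sum required in \<open>size_nonzeros_lt\<close>.\<close>

lemma sum_list_counting:
  assumes "x \<in> n_chains n"
  shows "sum_list (counting x) = n"
proof -
  have len: "length x = n" and lt: "\<And>i. i < n \<Longrightarrow> x ! i < n"
    using assms by (auto simp: n_chains_def)
  have "sum_list (counting x) = (\<Sum>j<n. card {i. i < n \<and> x ! i = j})"
    by (simp add: counting_def len interv_sum_list_conv_sum_set_nat atLeast0LessThan)
  also have "\<dots> = card (\<Union>j<n. {i. i < n \<and> x ! i = j})"
    by (subst card_UN_disjoint) auto
  also have "(\<Union>j<n. {i. i < n \<and> x ! i = j}) = {..<n}"
    using lt by auto
  finally show ?thesis by simp
qed

text \<open>Let \<open>c\<close> be the number of distinct multiplicities in \<open>M\<close>. They
  sum to at most \<open>size M\<close>, so c(c+1) <= 2 * \<open>size M\<close>, whereas two steps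
  leave at most c+2 members. If the size has not dropped, c(c+1) <= 2(c+2), hence c <= 2.\<close>

lemma size_step_step:
  assumes "size M \<le> size (step n (step n M))"
  shows "size (step n (step n M)) \<le> 4"
proof -
  define L where "L = image_mset (count M) (mset_set (set_mset M))"
  define c where "c = card (set_mset L)"
  have M': "step n M = add_mset (n - size M) L"
    by (simp add: step_def L_def)
  have "0 \<notin># L" by (auto simp: L_def count_eq_zero_iff)
  then have "c * (c + 1) \<le> 2 * \<Sum>(set_mset L)"
    unfolding c_def by (intro card_mult_Suc_card_le_sum) auto
  also have "\<dots> \<le> 2 * size M"
    using sum_set_mset_le[of L] by (simp add: L_def sum_image_count)
  finally have c: "c * (c + 1) \<le> 2 * size M" .
  \<comment> \<open>One unit of the 2 is for the possibly new value \<open>n - size M\<close>, the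
    other for the member that the second \<open>step\<close> adds.\<close>
  have k: "size (step n (step n M)) \<le> c + 2"
    unfolding step_def[of n "step n M"] unfolding M' c_def
    by (simp add: card_insert_if)
  have "c \<le> 2"
  proof (rule ccontr)
    assume "\<not> c \<le> 2"
    then have "3 * (c + 1) \<le> c * (c + 1)" by (intro mult_right_mono) auto
    moreover have "2 * size M \<le> 2 * (c + 2)" using k assms by simp
    ultimately have "3 * (c + 1) \<le> 2 * (c + 2)" using c by (meson order_trans)
    then show False using \<open>\<not> c \<le> 2\<close> by simp
  qed
  then show ?thesis using k by simp
qed

text \<open>These are the partitions of 1, 2, 3 and 4 into at most three parts; only 1+1+1+1 is
  excluded by the size.\<close>

lemma small_sum_mset:
  fixes L :: "nat multiset"
  assumes "0 \<notin># L" and "L \<noteq> {#}" and "sum_mset L \<le> 4" and "size L \<le> 3"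
  shows "L \<in> {{#1#}, {#2#}, {#3#}, {#4#}, {#1, 1#}, {#2, 1#}, {#3, 1#}, {#2, 2#},
    {#1, 1, 1#}, {#2, 1, 1#}}"
proof -
  obtain l where l: "L = mset l" by (metis ex_mset)
  have "size L \<noteq> 0" using assms(2) by simp
  then consider "size L = 1" | "size L = 2" | "size L = 3" using assms(4) by linarith
  then show ?thesis
  proof cases
    case 1
    then obtain a where L: "L = {#a#}" using size_1_singleton_mset by blast
    then have "a = 1 \<or> a = 2 \<or> a = 3 \<or> a = 4" using assms by auto
    then show ?thesis using L by auto
  next
    case 2
    then obtain a b where L: "L = {#a, b#}"
      using l by (auto simp: numeral_2_eq_2 length_Suc_conv)
    then have "(a, b) \<in> {(1,1), (1,2), (2,1), (1,3), (3,1), (2,2)}" using assms by auto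
    then show ?thesis using L by (auto simp: add_mset_commute)
  next
    case 3
    then obtain a b c where L: "L = {#a, b, c#}"
      using l by (auto simp: numeral_3_eq_3 length_Suc_conv)
    then have "(a, b, c) \<in> {(1,1,1), (1,1,2), (1,2,1), (2,1,1)}" using assms by auto
    then show ?thesis using L by (auto simp: add_mset_commute)
  qed
qed

section \<open>Invariant sets of chains and their profiles\<close>

text \<open>One setting for all three notions: \<open>C\<close> will be \<open>{x}\<close> for a
  perfect chain, \<open>{x, y}\<close> for an amicable pair and \<open>set xs\<close> for a sociable
  group.\<close>

locale invariant_chains =
  fixes n :: nat and C :: "nat list set"
  assumes chains: "C \<subseteq> n_chains n" and invariant: "counting ` C = C" and n_pos: "n > 0"
begin

abbreviation profiles where "profiles \<equiv> nonzeros ` C"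

lemma counting_in: "x \<in> C \<Longrightarrow> counting x \<in> C"
  using invariant by blast

text \<open>A preimage in \<open>C\<close> gives the entries the sum \<open>n\<close>, and the image
  is again a chain, so \<open>size_nonzeros_lt\<close> applies.\<close>

lemma profile_bounds:
  assumes "M \<in> profiles"
  shows "size M < n" "0 \<notin># M" "\<And>v. v \<in># M \<Longrightarrow> v < n"
proof -
  obtain x where x: "x \<in> C" "M = nonzeros x" using assms by blast
  obtain w where w: "w \<in> C" "x = counting w" using x invariant by blast
  have "sum_list x = n"
    using w sum_list_counting chains by blast
  then show "size M < n"
    using size_nonzeros_lt x counting_in chains n_pos by blast
  show "0 \<notin># M" using x by (simp add: nonzeros_def)
  show "v < n" if "v \<in># M" for v
    using that x chains by (fastforce simp: nonzeros_def n_chains_def in_set_conv_nth)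
qed

lemma counting_tally: "x \<in> C \<Longrightarrow> counting x = tally n (nonzeros x)"
  using chains by (auto simp: counting_eq_tally n_chains_def)

lemma nonzeros_counting: "x \<in> C \<Longrightarrow> nonzeros (counting x) = step n (nonzeros x)"
  unfolding counting_tally using profile_bounds by (intro nonzeros_tally) blast+

lemma step_image: "step n ` profiles = profiles"
proof -
  have "step n ` profiles = nonzeros ` counting ` C"
    by (auto simp: nonzeros_counting image_iff)
  then show ?thesis by (simp add: invariant)
qed

lemma step_preimage:
  assumes "M \<in> profiles"
  obtains K where "K \<in> profiles" "M = step n K"
  using assms step_image by (metis imageE)

lemma finite_chains: "finite C"
proof (rule finite_subset)
  show "C \<subseteq> {x. set x \<subseteq> {..<n} \<and> length x = n}"
    using chains by (fastforce simp: n_chains_def in_set_conv_nth)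
  show "finite {x. set x \<subseteq> {..<n} \<and> length x = n}"
    by (rule finite_lists_length_eq) simp
qed

text \<open>Going back two steps from a profile of maximal size reaches one that is no larger, which
  is the hypothesis of \<open>size_step_step\<close>.\<close>

lemma size_profile_le_4:
  assumes "M \<in> profiles"
  shows "size M \<le> 4"
proof -
  have fin: "finite (size ` profiles)" "size ` profiles \<noteq> {}" using finite_chains assms by auto
  obtain K where K: "K \<in> profiles" "size K = Max (size ` profiles)"
    using Max_in[OF fin] by (metis imageE)
  obtain K' where K': "K' \<in> profiles" "K = step n K'" using K(1) by (rule step_preimage)
  obtain K'' where K'': "K'' \<in> profiles" "K' = step n K''" using K'(1) by (rule step_preimage)
  have "size K'' \<le> size K" "size M \<le> size K"
    using K K''(1) assms fin by simp_all
  then show ?thesis using size_step_step[of K'' n] K'(2) K''(2) by simp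
qed

text \<open>\<open>L\<close> consists of the multiplicities in a preimage \<open>K\<close>, so its
  sum is \<open>size K\<close>. It is nonempty because an empty \<open>K\<close> would put the
  forbidden entry \<open>n\<close> into \<open>M\<close>.\<close>

lemma profile_decomposition:
  assumes "M \<in> profiles"
  obtains L where "M = add_mset (n - sum_mset L) L" "0 \<notin># L" "L \<noteq> {#}"
    "sum_mset L \<le> 4" "size L \<le> 3" "sum_mset L < n" "size L + 1 < n"
proof -
  obtain K where K: "K \<in> profiles" "M = step n K" using assms by (rule step_preimage)
  define L where "L = image_mset (count K) (mset_set (set_mset K))"
  have "M = add_mset (n - size K) L" using K by (simp add: step_def L_def)
  moreover have "sum_mset L = size K" by (simp add: L_def sum_image_count)
  moreover have "0 \<notin># L" by (auto simp: L_def count_eq_zero_iff)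
  moreover have "size K \<le> 4" "size M \<le> 4" "size K < n" "size M < n"
    using K assms size_profile_le_4 profile_bounds by auto
  moreover have "K \<noteq> {#}"
  proof
    assume "K = {#}"
    then have "n \<in># M" using K by (simp add: step_def)
    then show False using profile_bounds(3)[OF assms] by blast
  qed
  ultimately show ?thesis using that[of L] by (auto simp: L_def mset_set_empty_iff)
qed

text \<open>Since \<open>step n\<close> maps the profiles onto themselves, a set of candidates may
  be replaced by its image. Repeating this discards the candidates that lie on no cycle.\<close>

lemma profiles_subset_step:
  assumes "profiles \<subseteq> S" and "step n ` S \<subseteq> S'"
  shows "profiles \<subseteq> S'"
  using image_mono[OF assms(1), of "step n"] assms(2) unfolding step_image by (rule order_trans)

lemma chains_subset_tally:
  assumes "profiles \<subseteq> S"
  shows "C \<subseteq> tally n ` S"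
proof
  fix x assume "x \<in> C"
  then obtain w where "w \<in> C" "x = counting w" using invariant by blast
  then show "x \<in> tally n ` S" using assms counting_tally by auto
qed

lemma profiles_initial:
  "profiles \<subseteq> (\<lambda>L. add_mset (n - sum_mset L) L) `
     {L \<in> {{#1#}, {#2#}, {#3#}, {#4#}, {#1, 1#}, {#2, 1#}, {#3, 1#}, {#2, 2#}, {#1, 1, 1#},
       {#2, 1, 1#}}. sum_mset L < n \<and> size L + 1 < n}" (is "_ \<subseteq> ?S")
proof
  fix M assume "M \<in> profiles"
  then obtain L where L: "M = add_mset (n - sum_mset L) L" "0 \<notin># L" "L \<noteq> {#}"
    "sum_mset L \<le> 4" "size L \<le> 3" "sum_mset L < n" "size L + 1 < n"
    by (rule profile_decomposition)
  with small_sum_mset[OF L(2-5)] show "M \<in> ?S"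
    by blast
qed

section \<open>Shrinking the candidate profiles for each n\<close>

lemma profiles_4:
  assumes "n = 4"
  shows "profiles \<subseteq> {{#2, 1, 1#}, {#2, 2#}}"
proof -
  \<comment> \<open>Numerals become \<open>Suc\<close> terms and multisets get a canonical order, so
    that \<open>auto\<close> can evaluate \<open>step\<close> on each candidate and compare the
    results.\<close>
  note [simp] = step_def add_mset_commute numeral_eq_Suc assms
  show ?thesis
    by (rule profiles_subset_step[OF profiles_initial]) auto
qed

lemma profiles_5:
  assumes "n = 5"
  shows "profiles \<subseteq> {{#2, 2, 1#}}"
proof -
  note [simp] = step_def add_mset_commute numeral_eq_Suc assms
  have "profiles \<subseteq> {{#2, 2, 1#}, {#3, 1, 1#}}"
    by (rule profiles_subset_step[OF profiles_initial]) auto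
  then show ?thesis
    by (rule profiles_subset_step) auto
qed

lemma profiles_6:
  assumes "n = 6"
  shows "profiles \<subseteq> {{#3, 1, 1, 1#}, {#3, 2, 1#}}"
proof -
  note [simp] = step_def add_mset_commute numeral_eq_Suc assms
  have "profiles \<subseteq> {{#2, 2, 2#}, {#3, 1, 1, 1#}, {#3, 2, 1#}, {#3, 3#}, {#4, 1, 1#}, {#4, 2#}}"
    by (rule profiles_subset_step[OF profiles_initial]) auto
  then have "profiles \<subseteq> {{#3, 1, 1, 1#}, {#3, 2, 1#}, {#3, 3#}, {#4, 1, 1#}, {#4, 2#}}"
    by (rule profiles_subset_step) auto
  then have "profiles \<subseteq> {{#3, 1, 1, 1#}, {#3, 2, 1#}, {#4, 1, 1#}, {#4, 2#}}"
    by (rule profiles_subset_step) auto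
  then have "profiles \<subseteq> {{#3, 1, 1, 1#}, {#3, 2, 1#}, {#4, 1, 1#}}"
    by (rule profiles_subset_step) auto
  then show ?thesis
    by (rule profiles_subset_step) auto
qed

text \<open>Here n-4 = 3 meets the small entry 3. This produces the cycle {3,3,1}, {4,2,1},
  {4,1,1,1} of length 3, next to the fixed profile {3,2,1,1}.\<close>

lemma profiles_7:
  assumes "n = 7"
  shows "profiles \<subseteq> {{#3, 2, 1, 1#}, {#3, 3, 1#}, {#4, 1, 1, 1#}, {#4, 2, 1#}}"
proof -
  note [simp] = step_def add_mset_commute numeral_eq_Suc assms
  have "profiles \<subseteq> {{#3, 2, 1, 1#}, {#3, 3, 1#}, {#4, 1, 1, 1#}, {#4, 2, 1#}, {#5, 1, 1#}}"
    by (rule profiles_subset_step[OF profiles_initial]) auto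
  then show ?thesis
    by (rule profiles_subset_step) auto
qed

text \<open>From 8 on, n-4 exceeds 3, so the large entry is distinct from the small ones in every
  surviving profile and the pattern no longer depends on n.\<close>

lemma profiles_ge_8:
  assumes "n \<ge> 8"
  shows "profiles \<subseteq> {{#n - 4, 2, 1, 1#}, {#n - 4, 3, 1#}, {#n - 3, 1, 1, 1#}}"
proof -
  obtain m where m: "n = m + 8" using assms le_Suc_ex[of 8 n] by (auto simp: add.commute)
  note [simp] = step_def add_mset_commute numeral_eq_Suc m
  have "profiles \<subseteq> {{#m + 4, 2, 1, 1#}, {#m + 4, 3, 1#}, {#m + 5, 1, 1, 1#}, {#m + 5, 2, 1#},
      {#m + 6, 1, 1#}, {#m + 6, 2#}}"
    \<comment> \<open>The case \<open>m = 0\<close> is separate because the candidate with entries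
      \<open>m + 4\<close> and 4 then has a repeated member; it is the source of
      \<open>{#m + 6, 2#}\<close>.\<close>
    by (rule profiles_subset_step[OF profiles_initial]) (cases m; auto)
  then have "profiles \<subseteq> {{#m + 4, 2, 1, 1#}, {#m + 4, 3, 1#}, {#m + 5, 1, 1, 1#}, {#m + 5, 2, 1#},
      {#m + 6, 1, 1#}}"
    by (rule profiles_subset_step) auto
  then have "profiles \<subseteq> {{#m + 4, 2, 1, 1#}, {#m + 4, 3, 1#}, {#m + 5, 1, 1, 1#}, {#m + 5, 2, 1#}}"
    by (rule profiles_subset_step) auto
  then have "profiles \<subseteq> {{#m + 4, 2, 1, 1#}, {#m + 4, 3, 1#}, {#m + 5, 1, 1, 1#}}"
    by (rule profiles_subset_step) auto
  then show ?thesis by simp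
qed

end

section \<open>The infinite families and the images of the listed chains\<close>

definition perfect_list :: "nat \<Rightarrow> nat list" where
  "perfect_list n = [n - 4, 2, 1] @ replicate (n - 7) 0 @ [1, 0, 0, 0]"

definition amicable_list1 :: "nat \<Rightarrow> nat list" where
  "amicable_list1 n = [n - 4, 3, 0, 0] @ replicate (n - 8) 0 @ [0, 1, 0, 0]"

definition amicable_list2 :: "nat \<Rightarrow> nat list" where
  "amicable_list2 n = [n - 3, 1, 0, 1] @ replicate (n - 8) 0 @ [1, 0, 0, 0]"

lemma tally_ge_7:
  assumes "n \<ge> 7"
  shows "tally n {#n - 4, 2, 1, 1#} = perfect_list n"
  by (rule nth_equalityI)
    (use assms in \<open>auto simp: tally_def nth_append nth_Cons' perfect_list_def\<close>)

text \<open>The pairing is crosswise: the multiset in the first equation is the profile of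
  \<open>amicable_list2 n\<close>, that in the second the profile of
  \<open>amicable_list1 n\<close>.\<close>

lemma tally_ge_8:
  assumes "n \<ge> 8"
  shows "tally n {#n - 3, 1, 1, 1#} = amicable_list1 n"
    and "tally n {#n - 4, 3, 1#} = amicable_list2 n"
  by (rule nth_equalityI;
      use assms in \<open>auto simp: tally_def nth_append nth_Cons' amicable_list1_def amicable_list2_def\<close>)+

lemma counting_perfect_list:
  assumes "n \<ge> 7"
  shows "counting (perfect_list n) = perfect_list n"
proof -
  have "length (perfect_list n) = n" "nonzeros (perfect_list n) = {#n - 4, 2, 1, 1#}"
    using assms by (auto simp: nonzeros_def perfect_list_def)
  then show ?thesis
    using tally_ge_7[OF assms] by (simp add: counting_eq_tally)
qed

lemma counting_amicable_lists:
  assumes "n \<ge> 8"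
  shows "counting (amicable_list1 n) = amicable_list2 n"
    and "counting (amicable_list2 n) = amicable_list1 n"
proof -
  have "length (amicable_list1 n) = n" "nonzeros (amicable_list1 n) = {#n - 4, 3, 1#}"
    "length (amicable_list2 n) = n" "nonzeros (amicable_list2 n) = {#n - 3, 1, 1, 1#}"
    using assms by (auto simp: nonzeros_def amicable_list1_def amicable_list2_def)
  then show "counting (amicable_list1 n) = amicable_list2 n" "counting (amicable_list2 n) = amicable_list1 n"
    using tally_ge_8[OF assms] by (auto simp: counting_eq_tally)
qed

lemma amicable_lists_neq: "n \<ge> 8 \<Longrightarrow> amicable_list1 n \<noteq> amicable_list2 n"
  by (auto simp: amicable_list1_def amicable_list2_def)

lemma perfect_list_7: "perfect_list 7 = [3, 2, 1, 1, 0, 0, 0]"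
  by (simp add: perfect_list_def)

lemma counting_small:
  "counting [1, 2, 1, 0] = [1, 2, 1, 0]"
  "counting [2, 0, 2, 0] = [2, 0, 2, 0]"
  "counting [2, 1, 2, 0, 0] = [2, 1, 2, 0, 0]"
  "counting [2, 3, 0, 1, 0, 0] = [3, 1, 1, 1, 0, 0]"
  "counting [3, 1, 1, 1, 0, 0] = [2, 3, 0, 1, 0, 0]"
  "counting [3, 2, 1, 1, 0, 0, 0] = [3, 2, 1, 1, 0, 0, 0]"
  "counting [3, 3, 0, 0, 1, 0, 0] = [4, 1, 0, 2, 0, 0, 0]"
  "counting [4, 1, 0, 2, 0, 0, 0] = [4, 1, 1, 0, 1, 0, 0]"
  "counting [4, 1, 1, 0, 1, 0, 0] = [3, 3, 0, 0, 1, 0, 0]"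
  by (simp_all add: counting_eq_tally nonzeros_def tally_def upt_rec)

lemma n_chains_iff: "x \<in> n_chains n \<longleftrightarrow> length x = n \<and> (\<forall>v\<in>set x. v < n)"
  by (auto simp: n_chains_def all_set_conv_all_nth)

section \<open>Classification of perfect, amicable and sociable chains\<close>

lemma (in invariant_chains) chains_classification:
  shows "n = 4 \<Longrightarrow> C \<subseteq> {[1, 2, 1, 0], [2, 0, 2, 0]}"
    and "n = 5 \<Longrightarrow> C \<subseteq> {[2, 1, 2, 0, 0]}"
    and "n = 6 \<Longrightarrow> C \<subseteq> {[2, 3, 0, 1, 0, 0], [3, 1, 1, 1, 0, 0]}"
    and "n = 7 \<Longrightarrow> C \<subseteq> {[3, 2, 1, 1, 0, 0, 0], [3, 3, 0, 0, 1, 0, 0], [4, 1, 0, 2, 0, 0, 0],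
      [4, 1, 1, 0, 1, 0, 0]}"
    and "n \<ge> 8 \<Longrightarrow> C \<subseteq> {perfect_list n,
      amicable_list1 n,
      amicable_list2 n}"
proof -
  note [simp] = tally_def upt_rec
  show "n = 4 \<Longrightarrow> C \<subseteq> {[1, 2, 1, 0], [2, 0, 2, 0]}"
    using chains_subset_tally[OF profiles_4] by auto
  show "n = 5 \<Longrightarrow> C \<subseteq> {[2, 1, 2, 0, 0]}"
    using chains_subset_tally[OF profiles_5] by auto
  show "n = 6 \<Longrightarrow> C \<subseteq> {[2, 3, 0, 1, 0, 0], [3, 1, 1, 1, 0, 0]}"
    using chains_subset_tally[OF profiles_6] by auto
  show "n = 7 \<Longrightarrow> C \<subseteq> {[3, 2, 1, 1, 0, 0, 0], [3, 3, 0, 0, 1, 0, 0], [4, 1, 0, 2, 0, 0, 0],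
      [4, 1, 1, 0, 1, 0, 0]}"
    using chains_subset_tally[OF profiles_7] by auto
  assume "n \<ge> 8"
  then show "C \<subseteq> {perfect_list n,
      amicable_list1 n,
      amicable_list2 n}"
    using chains_subset_tally[OF profiles_ge_8] tally_ge_7 tally_ge_8 by (auto simp del: tally_def)
qed

lemma nat_ge_4_cases:
  fixes n :: nat
  assumes "n \<ge> 4"
  obtains "n = 4" | "n = 5" | "n = 6" | "n = 7" | "n \<ge> 8"
  using assms by linarith

lemma perfect_chain_iff:
  assumes "n \<ge> 4"
  shows "perfect_chain n x \<longleftrightarrow>
        n = 4 \<and> x = [1, 2, 1, 0] \<or>
        n = 4 \<and> x = [2, 0, 2, 0] \<or>
        n = 5 \<and> x = [2, 1, 2, 0, 0] \<or>
        n \<ge> 7 \<and> x = perfect_list n" (is "_ \<longleftrightarrow> ?R")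
proof
  assume px: "perfect_chain n x"
  then interpret invariant_chains n "{x}"
    using assms by unfold_locales (auto simp: perfect_chain_def)
  have fx: "counting x = x" using px by (simp add: perfect_chain_def)
  from assms show ?R
  proof (cases rule: nat_ge_4_cases)
    case 5
    then show ?thesis
      using chains_classification(5) fx counting_amicable_lists[OF 5] amicable_lists_neq[OF 5] by auto
  qed (use chains_classification fx counting_small perfect_list_7 in auto)
next
  assume ?R
  then show "perfect_chain n x"
    \<comment> \<open>\<open>[simplified]\<close> rewrites the entries 1 to \<open>Suc 0\<close>,
      the form they take in the goal during simplification.\<close>
    by (auto simp: perfect_chain_def n_chains_iff counting_small[simplified] counting_perfect_list)
      (auto simp: perfect_list_def)
qed

lemma amicable_chains_iff:
  assumes "n \<ge> 4"
  shows "amicable_chains n x y \<longleftrightarrow>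
        n = 6 \<and> {x, y} = {[2, 3, 0, 1, 0, 0], [3, 1, 1, 1, 0, 0]} \<or>
        n \<ge> 8 \<and> {x, y} = {amicable_list1 n,
                          amicable_list2 n}" (is "_ \<longleftrightarrow> ?R")
proof
  assume px: "amicable_chains n x y"
  then interpret invariant_chains n "{x, y}"
    using assms by unfold_locales (auto simp: amicable_chains_def)
  have fx: "counting x = y" "counting y = x" "x \<noteq> y" using px by (auto simp: amicable_chains_def)
  from assms show ?R
  proof (cases rule: nat_ge_4_cases)
    case 5
    then show ?thesis
      using chains_classification(5) fx counting_amicable_lists[OF 5] counting_perfect_list[of n] by auto
  qed (use chains_classification fx counting_small in auto)
next
  assume ?R
  then show "amicable_chains n x y"
    by (auto simp: amicable_chains_def n_chains_iff doubleton_eq_iff counting_small[simplified]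
      counting_amicable_lists) (auto simp: amicable_list1_def amicable_list2_def)
qed

lemma sociable_chains_3I:
  assumes "{a, b, c} \<subseteq> n_chains n" and "distinct [a, b, c]"
    and "counting a = b" and "counting b = c" and "counting c = a"
  shows "sociable_chains n 3 [a, b, c]"
proof -
  have "k < 3 \<longleftrightarrow> k = 0 \<or> k = 1 \<or> k = 2" "k + 1 < 3 \<longleftrightarrow> k = 0 \<or> k = 1" for k :: nat
    by auto
  then show ?thesis
    using assms by (auto simp: sociable_chains_def)
qed

text \<open>A listing of at least three distinct chains excludes candidates that return after one or
  two applications. What remains is the 3-cycle for \<open>n = 7\<close>, whose period forces
  \<open>l = 3\<close>.\<close>

lemma sociable_chains_iff:
  assumes "n \<ge> 4"
  shows "sociable_chains n l xs \<longleftrightarrow> n = 7 \<and> l = 3 \<and>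
        (\<exists>r. xs = rotate r [[3, 3, 0, 0, 1, 0, 0], [4, 1, 0, 2, 0, 0, 0], [4, 1, 1, 0, 1, 0, 0]])"
    (is "_ \<longleftrightarrow> ?R")
proof
  assume soc: "sociable_chains n l xs"
  then have l: "l \<ge> 3" "length xs = l" and dist: "distinct xs"
    and nxt: "\<And>k. k + 1 < l \<Longrightarrow> xs ! (k + 1) = counting (xs ! k)"
    and last: "counting (xs ! (l - 1)) = xs ! 0"
    by (auto simp: sociable_chains_def)
  have "counting ` set xs = set xs"
  proof (intro equalityI subsetI)
    fix y assume "y \<in> counting ` set xs"
    then obtain k where k: "k < l" "y = counting (xs ! k)" using l by (auto simp: in_set_conv_nth)
    show "y \<in> set xs"
    proof (cases "k + 1 < l")
      case True
      then show ?thesis using k nxt[of k] l nth_mem[of "k + 1" xs] by simp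
    next
      case False
      then have "k = l - 1" using k by simp
      then show ?thesis using k last l nth_mem[of 0 xs] by simp
    qed
  next
    fix y assume "y \<in> set xs"
    then obtain k where k: "k < l" "y = xs ! k" using l by (auto simp: in_set_conv_nth)
    show "y \<in> counting ` set xs"
    proof (cases k)
      case 0
      then have "y = counting (xs ! (l - 1))" "xs ! (l - 1) \<in> set xs" using k last l by auto
      then show ?thesis by blast
    next
      case (Suc j)
      then have "y = counting (xs ! j)" "xs ! j \<in> set xs" using k nxt[of j] l by auto
      then show ?thesis by blast
    qed
  qed
  then interpret invariant_chains n "set xs"
    using assms soc by unfold_locales (auto simp: sociable_chains_def in_set_conv_nth)
  have x0: "xs ! 0 \<in> set xs" using l by simp
  have x1: "xs ! 1 = counting (xs ! 0)" using nxt[of 0] l by simp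
  have x2: "xs ! 2 = counting (counting (xs ! 0))" using nxt[of 1] l x1 by (simp add: numeral_2_eq_2)
  \<comment> \<open>Index 2 exists because \<open>l\<close> is at least 3; this inequality removes
    both fixed points and amicable pairs.\<close>
  have ne: "counting (counting (xs ! 0)) \<noteq> xs ! 0"
    using dist l nth_eq_iff_index_eq[OF dist, of 2 0] x2 by simp
  from assms show ?R
  proof (cases rule: nat_ge_4_cases)
    case 4
    then have 3: "counting (counting (counting (xs ! 0))) = xs ! 0"
      using chains_classification(4) x0 ne counting_small by auto
    have "l = 3"
    proof (rule ccontr)
      assume "l \<noteq> 3"
      \<comment> \<open>Index 3 is valid since \<open>l\<close> exceeds 3, and the period 3 would
        repeat the first chain there.\<close>
      then have "xs ! 3 = xs ! 0" using nxt[of 2] l x2 3 by simp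
      then show False using nth_eq_iff_index_eq[OF dist, of 3 0] l \<open>l \<noteq> 3\<close> by simp
    qed
    then have xs: "xs = [xs ! 0, counting (xs ! 0), counting (counting (xs ! 0))]"
      using x1 x2 l by (auto intro!: nth_equalityI simp: nth_Cons' numeral_3_eq_3 less_Suc_eq numeral_2_eq_2)
    let ?c = "[[3, 3, 0, 0, 1, 0, 0], [4, 1, 0, 2, 0, 0, 0], [4, 1, 1, 0, 1, 0, 0]] :: nat list list"
    have "xs ! 0 \<in> {[3, 3, 0, 0, 1, 0, 0], [4, 1, 0, 2, 0, 0, 0], [4, 1, 1, 0, 1, 0, 0]}"
      using chains_classification(4) 4 x0 ne counting_small by auto
    then have "xs = rotate 0 ?c \<or> xs = rotate 1 ?c \<or> xs = rotate 2 ?c"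
      using xs counting_small by (auto simp: numeral_2_eq_2)
    then show ?thesis using 4 \<open>l = 3\<close> by blast
  next
    case 5
    then show ?thesis
      using chains_classification(5) x0 ne counting_amicable_lists[OF 5] counting_perfect_list[of n] by auto
  qed (use chains_classification x0 ne counting_small in auto)
next
  let ?c = "[[3, 3, 0, 0, 1, 0, 0], [4, 1, 0, 2, 0, 0, 0], [4, 1, 1, 0, 1, 0, 0]] :: nat list list"
  assume ?R
  then obtain r where r: "n = 7" "l = 3" "xs = rotate (r mod 3) ?c"
    by (metis rotate_conv_mod length_Cons list.size(3) numeral_3_eq_3)
  have "r mod 3 = 0 \<or> r mod 3 = 1 \<or> r mod 3 = 2" by linarith
  then have xs: "xs = ?c \<or> xs = rotate1 ?c \<or> xs = rotate1 (rotate1 ?c)"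
    using r(3) by (auto simp: numeral_2_eq_2)
  then obtain a b c where "xs = [a, b, c]" "{a, b, c} \<subseteq> n_chains n" "distinct [a, b, c]"
    "counting a = b" "counting b = c" "counting c = a"
    using r(1) counting_small by (elim disjE) (simp_all add: n_chains_iff)
  then show "sociable_chains n l xs"
    using r(2) sociable_chains_3I by simp
qed

theorem theorem4:
  fixes n :: nat
  assumes "n \<ge> 4"
  shows
    "(\<forall>x. perfect_chain n x \<longleftrightarrow>
        n = 4 \<and> x = [1, 2, 1, 0] \<or>
        n = 4 \<and> x = [2, 0, 2, 0] \<or>
        n = 5 \<and> x = [2, 1, 2, 0, 0] \<or>
        n \<ge> 7 \<and> x = [n - 4, 2, 1] @ replicate (n - 7) 0 @ [1, 0, 0, 0])
     \<and>
     (\<forall>x y. amicable_chains n x y \<longleftrightarrow>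
        n = 6 \<and> {x, y} = {[2, 3, 0, 1, 0, 0], [3, 1, 1, 1, 0, 0]} \<or>
        n \<ge> 8 \<and> {x, y} = {[n - 4, 3, 0, 0] @ replicate (n - 8) 0 @ [0, 1, 0, 0],
                          [n - 3, 1, 0, 1] @ replicate (n - 8) 0 @ [1, 0, 0, 0]})
     \<and>
     (\<forall>l xs. sociable_chains n l xs \<longleftrightarrow>
        n = 7 \<and> l = 3 \<and>
        (\<exists>r. xs = rotate r [[3, 3, 0, 0, 1, 0, 0], [4, 1, 0, 2, 0, 0, 0], [4, 1, 1, 0, 1, 0, 0]]))
     \<and>
     (\<forall>l>3. \<not> (\<exists>xs. sociable_chains n l xs))"
  using perfect_chain_iff[OF assms] amicable_chains_iff[OF assms] sociable_chains_iff[OF assms]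
  unfolding perfect_list_def amicable_list1_def amicable_list2_def by auto

end
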